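(* Let $X, Y\in\mathscr{M}_\lambda$, and further assume that $\dim(X)=\dim(Y)=0$ (Lebesgue covering dimension) if $\mu=\omega$. For every limit ordinal $\xi<\lambda^+$, \[\mathcal{M}_{\xi+1}(X,Y)=\mathrm{Fin}_\lambda\text{-}\!\lim\Big(\widehat{\lim}{}^{\xi}_{\operatorname{cof}(\xi)}\mathcal{M}_{<\xi}(X,Y)\Big).\]
   Context: Work in ZFC. $\lambda$ is an uncountable cardinal with $2^{<\lambda}=\lambda$, $\mu=\operatorname{cof}(\lambda)$. All spaces are regular Hausdorff. $\mathbb{G}=\mathbb{R}$ if $\mu=\omega$, otherwise a fixed ordered field with $\mathbb{G}^+$ of coinitiality $\mu$; $\mathscr{M}_\lambda$ is the class of spaces of weight $\le\lambda$ whose topology is induced by a $\mathbb{G}$-valued metric. $\boldsymbol{\Sigma}^0_1(X)$ = open sets; for $1<\xi<\lambda^+$, $\boldsymbol{\Sigma}^0_\xi(X)$ = all unions $\bigcup_{i<\lambda}A_i$ with $X\setminus A_i\in\bigcup_{\xi'<\xi}\boldsymbol{\Sigma}^0_{\xi'}(X)$. $\mathcal{M}_\xi(X,Y)$ = functions with $f^{-1}(U)\in\boldsymbol{\Sigma}^0_\xi(X)$ for all open $U\subseteq Y$; $\mathcal{M}_{<\xi}=\bigcup_{\xi'<\xi}\mathcal{M}_{\xi'}$. For a directed set $D$, $\lim_{d\in D}f_d$ is the pointwise limit of the net; $f=\widehat{\lim}{}^\xi_{d\in D}f_d$ means there is a covering $(X_d)_{d\in D}$ of $X$ with $X_d\subseteq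 X_{d'}$ for $d\le d'$, $X_d\in\boldsymbol{\Sigma}^0_\xi(X)$, and $f_{d'}\restriction X_d=f\restriction X_d$ whenever $d\le d'$. For a class $\mathcal{F}$: $D\text{-}\!\lim\mathcal{F}=\{\lim_{d\in D}f_d\mid f_d\in\mathcal{F}\}$ and $\widehat{\lim}{}^\xi_D\mathcal{F}=\{\widehat{\lim}{}^\xi_{d\in D}f_d\mid f_d\in\mathcal{F}\}$. $\mathrm{Fin}_\lambda$ is the set of finite subsets of $\lambda$ ordered by inclusion; the ordinal $\operatorname{cof}(\xi)$ carries its usual order. *)

theory Defs
  imports "HOL-Analysis.Analysis"
begin

unbundle cardinal_syntax

text \<open>A cardinal is a relation \<open>lam\<close> with \<open>Card_order lam\<close>; the elements of \<open>Field lam\<close> play the role of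
  the ordinals below \<open>lam\<close>, and the elements of \<open>Field (cardSuc lam)\<close> that of the ordinals below
  \<open>lam\<^sup>+\<close>. The ordinal represented by \<open>a\<close> is the order type of \<open>underS r a\<close>.\<close>

definition ord_zero :: "'o rel \<Rightarrow> 'o" where
  "ord_zero r = wo_rel.minim r (Field r)"

definition ord_succ :: "'o rel \<Rightarrow> 'o \<Rightarrow> 'o" where
  "ord_succ r a = wo_rel.suc r {a}"

definition ord_one :: "'o rel \<Rightarrow> 'o" where
  "ord_one r = ord_succ r (ord_zero r)"

definition ord_limit :: "'o rel \<Rightarrow> 'o \<Rightarrow> bool" where
  "ord_limit r a \<longleftrightarrow> a \<in> Field r \<and> a \<noteq> ord_zero r \<and>
     (\<forall>b\<in>underS r a. \<exists>c\<in>underS r a. b \<in> underS r c)"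

text \<open>\<open>2^(<lam)\<close> is the cardinality of the set of all binary sequences of length \<open>< lam\<close>.\<close>

definition two_pow_less :: "'k rel \<Rightarrow> ('k \<times> ('k \<Rightarrow> bool)) rel" where
  "two_pow_less lam = |SIGMA \<alpha>:Field lam. Func (underS lam \<alpha>) (UNIV :: bool set)|"

definition unbounded_in :: "'o rel \<Rightarrow> 'o set \<Rightarrow> bool" where
  "unbounded_in r A \<longleftrightarrow> A \<subseteq> Field r \<and> (\<forall>a\<in>Field r. \<exists>b\<in>A. (a, b) \<in> r)"

text \<open>The least cardinality of a cofinal subset. Its value is a cardinal order, hence also serves as
  the initial ordinal \<open>cof(r)\<close> with its usual order. Unlike \<^const>\<open>cofinal\<close>, the notion used here
  is not strict, so it is also meaningful for orders with a greatest element.\<close>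

definition cofinality :: "'o rel \<Rightarrow> 'o rel" where
  "cofinality r = |SOME A. unbounded_in r A \<and> (\<forall>B. unbounded_in r B \<longrightarrow> |A| \<le>o |B| )|"

definition ord_cof :: "'o rel \<Rightarrow> 'o \<Rightarrow> 'o rel" where
  "ord_cof r a = cofinality (Restr r (underS r a))"

text \<open>The coinitiality of the positive cone is the cofinality of its reversed order.\<close>

definition coinitiality_pos :: "'g::linordered_field itself \<Rightarrow> 'g rel" where
  "coinitiality_pos _ = cofinality {(x, y). 0 < x \<and> 0 < y \<and> y \<le> x}"

definition valued_metric_on :: "'a set \<Rightarrow> ('a \<Rightarrow> 'a \<Rightarrow> 'g::linordered_field) \<Rightarrow> bool" where
  "valued_metric_on S d \<longleftrightarrow>
     (\<forall>x\<in>S. \<forall>y\<in>S. 0 \<le> d x y \<and> (d x y = 0 \<longleftrightarrow> x = y) \<and> d x y = d y x) \<and>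
     (\<forall>x\<in>S. \<forall>y\<in>S. \<forall>z\<in>S. d x z \<le> d x y + d y z)"

definition valued_metrizable :: "'g::linordered_field itself \<Rightarrow> 'a topology \<Rightarrow> bool" where
  "valued_metrizable _ X \<longleftrightarrow>
     (\<exists>d :: 'a \<Rightarrow> 'a \<Rightarrow> 'g. valued_metric_on (topspace X) d \<and>
        (\<forall>U. openin X U \<longleftrightarrow> U \<subseteq> topspace X \<and>
           (\<forall>x\<in>U. \<exists>\<epsilon>>0. \<forall>y\<in>topspace X. d x y < \<epsilon> \<longrightarrow> y \<in> U)))"

definition weight_le :: "'a topology \<Rightarrow> 'k rel \<Rightarrow> bool" where
  "weight_le X lam \<longleftrightarrow>
     (\<exists>\<B>. |\<B>| \<le>o lam \<and> (\<forall>V\<in>\<B>. openin X V) \<and>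
          (\<forall>U x. openin X U \<and> x \<in> U \<longrightarrow> (\<exists>V\<in>\<B>. x \<in> V \<and> V \<subseteq> U)))"

text \<open>The field of values is \<^typ>\<open>real\<close> if \<open>cof(lam) = \<omega>\<close>, and \<open>'g\<close> otherwise.\<close>

definition metric_class :: "'g::linordered_field itself \<Rightarrow> 'k rel \<Rightarrow> 'a topology set" where
  "metric_class G lam =
     {X. regular_space X \<and> Hausdorff_space X \<and> weight_le X lam \<and>
         (if cofinality lam =o natLeq then valued_metrizable TYPE(real) X
          else valued_metrizable G X)}"

text \<open>Every finite open cover has a finite open refinement such that each point lies in at most
  \<open>n + 1\<close> of its members; so \<open>n = -1\<close> characterizes the empty space.\<close>

definition covering_dim_le :: "'a topology \<Rightarrow> int \<Rightarrow> bool" where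
  "covering_dim_le X n \<longleftrightarrow>
     (\<forall>\<U>. finite \<U> \<and> (\<forall>U\<in>\<U>. openin X U) \<and> \<Union>\<U> = topspace X \<longrightarrow>
        (\<exists>\<V>. finite \<V> \<and> (\<forall>V\<in>\<V>. openin X V) \<and> \<Union>\<V> = topspace X \<and>
             (\<forall>V\<in>\<V>. \<exists>U\<in>\<U>. V \<subseteq> U) \<and>
             (\<forall>x\<in>topspace X. int (card {V\<in>\<V>. x \<in> V}) \<le> n + 1)))"

definition has_covering_dim :: "'a topology \<Rightarrow> int \<Rightarrow> bool" where
  "has_covering_dim X n \<longleftrightarrow> covering_dim_le X n \<and> \<not> covering_dim_le X (n - 1)"

text \<open>\<open>Sigma0 lam X \<xi> A\<close> means \<open>A \<in> \<Sigma>\<^sup>0\<^sub>\<xi>(X)\<close>, for \<open>1 \<le> \<xi> < lam\<^sup>+\<close>. No set belongs to the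
  (meaningless) class with index \<open>0\<close>.\<close>

inductive Sigma0 :: "'k rel \<Rightarrow> 'a topology \<Rightarrow> 'k set \<Rightarrow> 'a set \<Rightarrow> bool"
  for lam :: "'k rel" and X :: "'a topology" where
  Sigma0_one: "openin X U \<Longrightarrow> Sigma0 lam X (ord_one (cardSuc lam)) U"
| Sigma0_Union:
    "\<lbrakk>ord_one (cardSuc lam) \<in> underS (cardSuc lam) \<xi>;
      \<And>i. i \<in> Field lam \<Longrightarrow> A i \<subseteq> topspace X;
      \<And>i. i \<in> Field lam \<Longrightarrow> \<exists>\<xi>'\<in>underS (cardSuc lam) \<xi>. Sigma0 lam X \<xi>' (topspace X - A i)\<rbrakk>
     \<Longrightarrow> Sigma0 lam X \<xi> (\<Union>i\<in>Field lam. A i)"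

text \<open>Functions \<open>X \<rightarrow> Y\<close> are extensional on the underlying set of \<open>X\<close>, so that equality of classes of
  functions is equality of sets.\<close>

definition meas_fun :: "'k rel \<Rightarrow> 'k set \<Rightarrow> 'a topology \<Rightarrow> 'b topology \<Rightarrow> ('a \<Rightarrow> 'b) set" where
  "meas_fun lam \<xi> X Y =
     {f \<in> topspace X \<rightarrow>\<^sub>E topspace Y. \<forall>U. openin Y U \<longrightarrow> Sigma0 lam X \<xi> {x \<in> topspace X. f x \<in> U}}"

definition meas_fun_less :: "'k rel \<Rightarrow> 'k set \<Rightarrow> 'a topology \<Rightarrow> 'b topology \<Rightarrow> ('a \<Rightarrow> 'b) set" where
  "meas_fun_less lam \<xi> X Y =
     (\<Union>\<xi>'\<in>underS (cardSuc lam) \<xi> - {ord_zero (cardSuc lam)}. meas_fun lam \<xi>' X Y)"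

text \<open>A directed set is given by its reflexive order relation \<open>D\<close>, with carrier \<open>Field D\<close>. Its filter
  of tails is the one along which nets indexed by \<open>D\<close> converge.\<close>

definition tails :: "'d rel \<Rightarrow> 'd filter" where
  "tails D = (INF d\<in>Field D. principal {e. (d, e) \<in> D})"

definition net_lim ::
  "'d rel \<Rightarrow> 'a topology \<Rightarrow> 'b topology \<Rightarrow> ('a \<Rightarrow> 'b) set \<Rightarrow> ('a \<Rightarrow> 'b) set" where
  "net_lim D X Y \<F> =
     {f \<in> topspace X \<rightarrow>\<^sub>E topspace Y.
        \<exists>g. (\<forall>d\<in>Field D. g d \<in> \<F>) \<and>
            (\<forall>x\<in>topspace X. limitin Y (\<lambda>d. g d x) (f x) (tails D))}"

definition stable_lim ::
  "'k rel \<Rightarrow> 'k set \<Rightarrow> 'd rel \<Rightarrow> 'a topology \<Rightarrow> 'b topology \<Rightarrow> ('a \<Rightarrow> 'b) set \<Rightarrow> ('a \<Rightarrow> 'b) set" where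
  "stable_lim lam \<xi> D X Y \<F> =
     {f \<in> topspace X \<rightarrow>\<^sub>E topspace Y.
        \<exists>g C. (\<forall>d\<in>Field D. g d \<in> \<F>) \<and>
              (\<Union>d\<in>Field D. C d) = topspace X \<and>
              (\<forall>d\<in>Field D. Sigma0 lam X \<xi> (C d)) \<and>
              (\<forall>d e. (d, e) \<in> D \<longrightarrow> C d \<subseteq> C e \<and> (\<forall>x\<in>C d. g e x = f x))}"

definition Fin_order :: "'k rel \<Rightarrow> 'k set rel" where
  "Fin_order lam = {(a, b). finite b \<and> b \<subseteq> Field lam \<and> a \<subseteq> b}"

end

theory Submission
  imports Defs
begin

text \<open>For the inclusion from left to right, write \<open>f\<^sup>-\<^sup>1(b\<^sub>i) = \<Union>\<^sub>j A\<^sub>i\<^sub>j\<close> for a base \<open>(b\<^sub>i)\<close> of \<open>Y\<close>,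
  with all \<open>A\<^sub>i\<^sub>j\<close> in \<open>\<Pi>\<^sup>0\<^sub>\<xi>\<close>. Given a finite set \<open>F\<close> of indices \<open>p = (i, j)\<close>, it suffices to find a
  stable limit \<open>g\<^sub>F\<close> with \<open>g\<^sub>F(x) \<in> b\<^sub>i\<close> whenever \<open>x \<in> A\<^sub>p\<close> and \<open>p \<in> F\<close>: then \<open>g\<^sub>F(x)\<close> converges to
  \<open>f(x)\<close> along \<open>F\<close>. Write the complement of \<open>A\<^sub>p\<close> as an increasing union of sets \<open>U\<^sub>p\<^sub>d\<close>,
  \<open>d < cof(\<xi>)\<close>, of classes below \<open>\<xi>\<close>. At stage \<open>d\<close> the set \<open>T\<^sub>d(x)\<close> of those \<open>p \<in> F\<close> with
  \<open>x \<notin> U\<^sub>p\<^sub>d\<close> contains every \<open>p \<in> F\<close> with \<open>x \<in> A\<^sub>p\<close>, and it equals the set of these for large \<open>d\<close>.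
  At the first stage where the sets \<open>A\<^sub>p\<close>, \<open>p \<in> T\<^sub>d(x)\<close>, have a common point \<open>x'\<close>, put
  \<open>g\<^sub>F(x) = f(x')\<close>, with \<open>x'\<close> depending on \<open>T\<^sub>d(x)\<close> only. That this happens by stage \<open>d\<close> is a
  condition on \<open>x\<close> of class below \<open>\<xi>\<close>, so \<open>g\<^sub>F\<close> is a stable limit.

  Conversely, stable limits are \<open>\<Sigma>\<^sup>0\<^sub>\<xi>\<close>-measurable, and the preimage of an open set \<open>U\<close> under a limit
  of functions \<open>g\<^sub>F\<close> is the union, over all \<open>b\<^sub>i\<close> with closure inside \<open>U\<close> and all \<open>F\<close>, of
  \<open>\<Inter>\<^sub>F\<^sub>'\<^sub>\<supseteq>\<^sub>F g\<^sub>F\<^sub>'\<^sup>-\<^sup>1(cl b\<^sub>i)\<close>.\<close>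

section \<open>Cardinals, cofinality and bases\<close>

lemma card_of_underS_cardSuc:
  assumes "Card_order lam" "a \<in> Field (cardSuc lam)"
  shows "|underS (cardSuc lam) a| \<le>o lam"
  using assms
  by (metis cardSuc_Card_order cardSuc_ordLeq_ordLess card_of_Card_order card_of_underS)

text \<open>Cardinals are well-ordered and, by reflexivity, the whole field is unbounded. So the
  choice in \<open>cofinality\<close> is made from a nonempty collection and attains the
  minimum.\<close>

lemma cofinality_card_of:
  assumes "Refl r"
  obtains A where "cofinality r = |A|" "unbounded_in r A"
    "\<And>B. unbounded_in r B \<Longrightarrow> |A| \<le>o |B|"
proof -
  define R where "R = card_of ` {A. unbounded_in r A}"
  have "unbounded_in r (Field r)"
    using assms by (auto simp: unbounded_in_def refl_on_def)
  then have "R \<noteq> {}" "\<forall>s\<in>R. Card_order s"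
    by (auto simp: R_def card_of_Card_order)
  then obtain s where "s \<in> R" "\<forall>s'\<in>R. s \<le>o s'"
    using exists_minim_Card_order by blast
  then have "\<exists>A. unbounded_in r A \<and> (\<forall>B. unbounded_in r B \<longrightarrow> |A| \<le>o |B| )"
    by (auto simp: R_def)
  from someI_ex[OF this] show ?thesis
    by (intro that[of "SOME A. unbounded_in r A \<and> (\<forall>B. unbounded_in r B \<longrightarrow> |A| \<le>o |B| )"])
      (auto simp: cofinality_def)
qed

lemma card_of_ordLeq_enumerate:
  assumes "Card_order lam" "|I| \<le>o lam" "I \<noteq> {}"
  obtains h where "h ` Field lam = I"
proof -
  have "|I| \<le>o |Field lam|"
    by (rule ordLeq_ordIso_trans[OF assms(2) ordIso_symmetric[OF card_of_Field_ordIso[OF assms(1)]]])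
  then have "\<exists>h. h ` Field lam = I"
    by (rule iffD2[OF card_of_ordLeq2[OF \<open>I \<noteq> {}\<close>]])
  then show ?thesis using that by auto
qed

lemma weight_le_enumerate:
  assumes "Card_order lam" "weight_le X lam"
  obtains b where "\<And>i. i \<in> Field lam \<Longrightarrow> openin X (b i)"
    "\<And>U x. openin X U \<Longrightarrow> x \<in> U \<Longrightarrow> \<exists>i\<in>Field lam. x \<in> b i \<and> b i \<subseteq> U"
proof -
  from assms obtain \<B> where B: "|\<B>| \<le>o lam" "\<forall>V\<in>\<B>. openin X V"
    "\<forall>U x. openin X U \<and> x \<in> U \<longrightarrow> (\<exists>V\<in>\<B>. x \<in> V \<and> V \<subseteq> U)"
    unfolding weight_le_def by metis
  show ?thesis
  proof (cases "\<B> = {}")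
    case True
    \<comment> \<open>An empty base leaves no nonempty open set, so the constant empty family will
      do.\<close>
    then show ?thesis using B by (intro that[of "\<lambda>_. {}"]) auto
  next
    case False
    then obtain h where "h ` Field lam = \<B>"
      using card_of_ordLeq_enumerate assms(1) B(1) by metis
    then show ?thesis using B by (intro that[of h]) blast+
  qed
qed

text \<open>Regularity shrinks \<open>U\<close> to a neighbourhood with closure inside
  \<open>U\<close>, and a basic set is taken inside that one. This serves both to write open sets as
  unions of closed sets and to control limits.\<close>

lemma regular_base_closure:
  assumes "regular_space X" "openin X U" "x \<in> U"
    and "\<And>U x. openin X U \<Longrightarrow> x \<in> U \<Longrightarrow> \<exists>i\<in>I. x \<in> b i \<and> b i \<subseteq> U"
  shows "\<exists>i\<in>I. x \<in> b i \<and> X closure_of b i \<subseteq> U"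
proof -
  obtain V where V: "openin X V" "x \<in> V" "X closure_of V \<subseteq> U"
    using assms(1-3)
    unfolding neighbourhood_base_of_closedin[symmetric] neighbourhood_base_of
    by (meson closure_of_minimal subset_iff subset_trans)
  then obtain i where "i \<in> I" "x \<in> b i" "b i \<subseteq> V" using assms(4) by blast
  then show ?thesis using V closure_of_mono by blast
qed

section \<open>Finite subsets of \<open>lam\<close> as a directed set\<close>

lemma Field_Fin_order: "Field (Fin_order lam) = Fpow (Field lam)"
  by (auto simp: Fin_order_def Field_def Fpow_def intro: finite_subset)

lemma tails_Fin_order: "tails (Fin_order lam) = finite_subsets_at_top (Field lam)"
proof -
  have "{b. (a, b) \<in> Fin_order lam} = {b. finite b \<and> a \<subseteq> b \<and> b \<subseteq> Field lam}" for a
    by (auto simp: Fin_order_def)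
  then show ?thesis
    unfolding tails_def finite_subsets_at_top_def Field_Fin_order Fpow_def by (simp add: conj_commute)
qed

lemma eventually_finite_subsets_Fpow:
  "eventually P (finite_subsets_at_top A) \<longleftrightarrow> (\<exists>F\<in>Fpow A. \<forall>F'\<in>Fpow A. F \<subseteq> F' \<longrightarrow> P F')"
  unfolding eventually_finite_subsets_at_top Fpow_def Bex_def Ball_def mem_Collect_eq
  by (intro ex_cong1) (metis (no_types, lifting))

section \<open>The Borel hierarchy\<close>

locale lambda_hierarchy =
  fixes lam :: "'k rel" and X :: "'a topology"
  assumes card: "Card_order lam" and inf: "natLeq \<le>o lam"
    and reg: "regular_space X" and weight: "weight_le X lam"
begin

abbreviation r where "r \<equiv> cardSuc lam"
abbreviation less (infix "\<lless>" 50) where "a \<lless> b \<equiv> a \<in> underS r b"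

section \<open>Ordinals below the successor cardinal of \<open>lam\<close>\<close>

lemma Card_r: "Card_order r"
  using card by (rule cardSuc_Card_order)

lemma wo_r: "wo_rel r"
  using Card_r by (simp add: card_order_on_well_order_on wo_rel_def)

lemma infinite_lam: "infinite (Field lam)"
  using cinfinite_mono[OF inf natLeq_cinfinite] by (simp add: cinfinite_def)

lemma Field_lam_ordLeq: "|Field lam| \<le>o lam"
  by (rule ordIso_imp_ordLeq[OF card_of_Field_ordIso[OF card]])

lemma subset_Field_lam_ordLeq: "I \<subseteq> Field lam \<Longrightarrow> |I| \<le>o lam"
  using card_of_mono1 Field_lam_ordLeq by (rule ordLeq_transitive)

lemma Times_ordLeq: "|I| \<le>o lam \<Longrightarrow> |J| \<le>o lam \<Longrightarrow> |I \<times> J| \<le>o lam"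
  by (rule card_of_Times_ordLeq_infinite_Field[OF infinite_lam _ _ card])

lemma infinite_r: "infinite (Field r)"
  using card infinite_lam by (simp add: cardSuc_finite)

lemma less_Field: "a \<lless> b \<Longrightarrow> a \<in> Field r \<and> b \<in> Field r"
  by (auto simp: underS_def Field_def)

lemma less_trans: "a \<lless> b \<Longrightarrow> b \<lless> c \<Longrightarrow> a \<lless> c"
  by (metis wo_rel.TRANS[OF wo_r] wo_rel.ANTISYM[OF wo_r] transD antisymD underS_I underS_E)

lemma le_less_trans: "(a, b) \<in> r \<Longrightarrow> b \<lless> c \<Longrightarrow> a \<lless> c"
  by (metis less_trans underS_I)

lemma less_linear: "a \<in> Field r \<Longrightarrow> b \<in> Field r \<Longrightarrow> a \<lless> b \<or> a = b \<or> b \<lless> a"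
  using wo_rel.TOTALS[OF wo_r] by (auto simp: underS_def)

lemma le_iff: "a \<in> Field r \<Longrightarrow> (a, b) \<in> r \<longleftrightarrow> a \<lless> b \<or> a = b"
  using wo_rel.REFL[OF wo_r] by (auto simp: underS_def refl_on_def)

text \<open>An infinite cardinal has no last element; hence \<open>ord_succ\<close> is a genuine
  successor on all of \<open>Field r\<close>.\<close>

lemma AboveS_nonempty: "a \<in> Field r \<Longrightarrow> AboveS r {a} \<noteq> {}"
  using infinite_Card_order_limit[OF Card_r infinite_r, of a] by (auto simp: AboveS_def Field_def)

lemma less_succ: "a \<in> Field r \<Longrightarrow> a \<lless> ord_succ r a"
  using wo_rel.suc_greater[OF wo_r _ AboveS_nonempty, of a a]
  by (auto simp: ord_succ_def underS_def)

lemma succ_Field: "a \<in> Field r \<Longrightarrow> ord_succ r a \<in> Field r"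
  using less_succ less_Field by blast

lemma succ_least: "a \<lless> b \<Longrightarrow> (ord_succ r a, b) \<in> r"
  unfolding ord_succ_def
  by (rule wo_rel.suc_least_AboveS[OF wo_r]) (auto simp: AboveS_def underS_def Field_def)

lemma less_succ_iff: "a \<in> Field r \<Longrightarrow> b \<lless> ord_succ r a \<longleftrightarrow> (b, a) \<in> r"
  by (metis less_linear[of a b] succ_least[of a b] le_less_trans[of b a] less_succ le_iff[of b a]
      less_Field underS_E[of b] wo_rel.ANTISYM[OF wo_r] antisymD)

lemma zero_Field: "ord_zero r \<in> Field r"
  unfolding ord_zero_def using wo_rel.minim_in[OF wo_r, of "Field r"] infinite_r by fastforce

lemma zero_least: "a \<in> Field r \<Longrightarrow> (ord_zero r, a) \<in> r"
  unfolding ord_zero_def using wo_rel.minim_least[OF wo_r, of "Field r"] by blast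

lemma one_Field: "ord_one r \<in> Field r"
  by (simp add: ord_one_def succ_Field zero_Field)

lemma one_least: "a \<lless> b \<Longrightarrow> (ord_one r, b) \<in> r"
  unfolding ord_one_def using succ_least zero_least le_less_trans less_Field by blast

lemma limit_succ: "ord_limit r \<xi> \<Longrightarrow> a \<lless> \<xi> \<Longrightarrow> ord_succ r a \<lless> \<xi>"
  unfolding ord_limit_def using succ_least le_less_trans by blast

lemma limit_one: "ord_limit r \<xi> \<Longrightarrow> ord_one r \<lless> \<xi>"
  unfolding ord_one_def
  by (rule limit_succ) (auto simp: ord_limit_def underS_def zero_least)

text \<open>Lets one index in \<open>Field lam\<close> code a pair, so that members of
  \<open>Fin_order lam\<close> become finite sets of pairs (basic set, piece of its
  preimage).\<close>

lemma enumerate_pairs: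
  obtains h where "h ` Field lam = Field lam \<times> Field lam"
proof -
  have "|Field lam \<times> Field lam| \<le>o lam"
    by (intro Times_ordLeq Field_lam_ordLeq)
  moreover have "Field lam \<times> Field lam \<noteq> {}"
    using infinite_lam by auto
  ultimately show ?thesis
    by (rule card_of_ordLeq_enumerate[OF card _ _ that])
qed

lemma finite_ordLeq: "finite I \<Longrightarrow> |I| \<le>o lam"
  by (rule ordLess_imp_ordLeq[OF ordLess_ordLeq_trans[OF _ inf]]) (simp add: finite_iff_ordLess_natLeq)

section \<open>Closure properties of the classes \<open>Sigma0\<close>\<close>

lemma Sigma0_index: "Sigma0 lam X \<zeta> S \<Longrightarrow> \<zeta> \<in> Field r \<and> (ord_one r, \<zeta>) \<in> r"
  by (induction rule: Sigma0.induct) (auto simp: le_iff one_Field less_Field)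

lemma Sigma0_subset: "Sigma0 lam X \<zeta> S \<Longrightarrow> S \<subseteq> topspace X"
  by (induction rule: Sigma0.induct) (auto dest: openin_subset)

lemma Sigma0_one_iff: "Sigma0 lam X (ord_one r) S \<longleftrightarrow> openin X S"
  by (auto simp: Sigma0.simps[of _ _ "ord_one r"] underS_def)

lemma Sigma0_UnionE:
  assumes "Sigma0 lam X \<zeta> S" "ord_one r \<lless> \<zeta>"
  obtains A z where "S = (\<Union>i\<in>Field lam. A i)"
    "\<And>i. i \<in> Field lam \<Longrightarrow> A i \<subseteq> topspace X \<and> z i \<lless> \<zeta> \<and> Sigma0 lam X (z i) (topspace X - A i)"
  using assms(1)
proof cases
  case Sigma0_one
  then show ?thesis using assms(2) by (auto simp: underS_def)
next
  case (Sigma0_Union A)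
  then show ?thesis using that[of A] by metis
qed

text \<open>Frees the index set from being \<open>Field lam\<close>, by enumerating it with
  repetitions.\<close>

lemma Sigma0_UnionI:
  assumes "ord_one r \<lless> \<zeta>" "|I| \<le>o lam"
    and A: "\<And>i. i \<in> I \<Longrightarrow> A i \<subseteq> topspace X"
      "\<And>i. i \<in> I \<Longrightarrow> \<exists>z. z \<lless> \<zeta> \<and> Sigma0 lam X z (topspace X - A i)"
  shows "Sigma0 lam X \<zeta> (\<Union>i\<in>I. A i)"
proof (cases "I = {}")
  case True
  \<comment> \<open>The empty index set cannot be enumerated; its union is a union of
    \<open>lam\<close> empty sets, whose complements are open.\<close>
  have "Sigma0 lam X \<zeta> (\<Union>i\<in>Field lam. {})"
    using assms(1) by (intro Sigma0_Union) (auto intro!: bexI[of _ "ord_one r"] simp: Sigma0_one_iff)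
  with True show ?thesis by simp
next
  case False
  then obtain h where h: "h ` Field lam = I"
    using card_of_ordLeq_enumerate card assms(2) by metis
  have "Sigma0 lam X \<zeta> (\<Union>i\<in>Field lam. A (h i))"
    using h A assms(1) by (intro Sigma0_Union) blast+
  then show ?thesis by (simp add: h[symmetric])
qed

text \<open>Above level one the same union works for every larger index. An open set is the union of
  the closures of the basic sets whose closure it contains, and complements of closures have level
  one.\<close>

lemma Sigma0_mono_less:
  assumes "Sigma0 lam X \<zeta> S" "\<zeta> \<lless> \<zeta>'"
  shows "Sigma0 lam X \<zeta>' S"
  using assms(1)
proof cases
  case Sigma0_one
  obtain b where b: "\<And>i. i \<in> Field lam \<Longrightarrow> openin X (b i)"
    "\<And>U x. openin X U \<Longrightarrow> x \<in> U \<Longrightarrow> \<exists>i\<in>Field lam. x \<in> b i \<and> b i \<subseteq> U"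
    using weight_le_enumerate card weight by metis
  define I where "I = {i \<in> Field lam. X closure_of b i \<subseteq> S}"
  have "S = (\<Union>i\<in>I. X closure_of b i)"
  proof
    show "S \<subseteq> (\<Union>i\<in>I. X closure_of b i)"
    proof
      fix x assume "x \<in> S"
      then obtain i where "i \<in> Field lam" "x \<in> b i" "X closure_of b i \<subseteq> S"
        using regular_base_closure[OF reg] Sigma0_one b(2) by metis
      then show "x \<in> (\<Union>i\<in>I. X closure_of b i)"
        using closure_of_subset[OF openin_subset[OF b(1)]] by (auto simp: I_def)
    qed
  qed (auto simp: I_def)
  moreover have "Sigma0 lam X \<zeta>' (\<Union>i\<in>I. X closure_of b i)"
  proof (rule Sigma0_UnionI)
    show "|I| \<le>o lam"
      by (auto simp: I_def intro: subset_Field_lam_ordLeq)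
    show "\<exists>z. z \<lless> \<zeta>' \<and> Sigma0 lam X z (topspace X - X closure_of b i)" for i
      using assms(2) Sigma0_one Sigma0.Sigma0_one by (metis closedin_closure_of openin_diff openin_topspace)
  qed (use assms(2) Sigma0_one closure_of_subset_topspace[of X] in auto)
  ultimately show ?thesis by simp
next
  case (Sigma0_Union A)
  then show ?thesis using assms(2) less_trans by (metis Sigma0.Sigma0_Union)
qed

lemma Sigma0_mono: "Sigma0 lam X \<zeta> S \<Longrightarrow> (\<zeta>, \<zeta>') \<in> r \<Longrightarrow> Sigma0 lam X \<zeta>' S"
  using Sigma0_mono_less Sigma0_index le_iff by blast

lemma Sigma0_Diff:
  assumes "Sigma0 lam X \<zeta> S" "\<zeta> \<lless> \<zeta>'"
  shows "Sigma0 lam X \<zeta>' (topspace X - S)"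
proof -
  have "topspace X - (topspace X - S) = S"
    using Sigma0_subset[OF assms(1)] by blast
  then have "Sigma0 lam X \<zeta>' (\<Union>i\<in>{()}. topspace X - S)"
    using assms le_less_trans[OF conjunct2[OF Sigma0_index[OF assms(1)]] assms(2)]
    by (intro Sigma0_UnionI) (auto simp: finite_ordLeq)
  then show ?thesis by simp
qed

text \<open>At level one this is a union of open sets; above it, a double union is flattened, and a
  product of two index sets of size at most \<open>lam\<close> still has size at most
  \<open>lam\<close>.\<close>

lemma Sigma0_UN:
  assumes "(ord_one r, \<zeta>) \<in> r" "|I| \<le>o lam" "\<And>i. i \<in> I \<Longrightarrow> Sigma0 lam X \<zeta> (S i)"
  shows "Sigma0 lam X \<zeta> (\<Union>i\<in>I. S i)"
proof (cases "\<zeta> = ord_one r")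
  case True
  then show ?thesis using assms(3) by (auto simp: Sigma0_one_iff)
next
  case False
  then have one: "ord_one r \<lless> \<zeta>" using assms(1) by (auto simp: underS_def)
  have "\<forall>i\<in>I. \<exists>A z. S i = (\<Union>k\<in>Field lam. A k) \<and>
    (\<forall>k\<in>Field lam. A k \<subseteq> topspace X \<and> z k \<lless> \<zeta> \<and> Sigma0 lam X (z k) (topspace X - A k))"
    using assms(3) Sigma0_UnionE one by metis
  then obtain A z where A: "\<And>i. i \<in> I \<Longrightarrow> S i = (\<Union>k\<in>Field lam. A i k)"
    "\<And>i k. i \<in> I \<Longrightarrow> k \<in> Field lam \<Longrightarrow> A i k \<subseteq> topspace X \<and> z i k \<lless> \<zeta> \<and>
      Sigma0 lam X (z i k) (topspace X - A i k)"
    by metis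
  have "|I \<times> Field lam| \<le>o lam"
    by (intro Times_ordLeq Field_lam_ordLeq assms(2))
  then have "Sigma0 lam X \<zeta> (\<Union>q\<in>I \<times> Field lam. A (fst q) (snd q))"
    using A(2) by (intro Sigma0_UnionI one) fastforce+
  moreover have "(\<Union>q\<in>I \<times> Field lam. A (fst q) (snd q)) = (\<Union>i\<in>I. S i)"
    using A(1) by fastforce
  ultimately show ?thesis by simp
qed

lemma Sigma0_empty: "(ord_one r, \<zeta>) \<in> r \<Longrightarrow> Sigma0 lam X \<zeta> {}"
  using Sigma0_mono[of "ord_one r"] by (simp add: Sigma0_one_iff)

lemma Sigma0_topspace: "(ord_one r, \<zeta>) \<in> r \<Longrightarrow> Sigma0 lam X \<zeta> (topspace X)"
  using Sigma0_mono[of "ord_one r"] by (simp add: Sigma0_one_iff)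

lemma Sigma0_Un:
  assumes "Sigma0 lam X \<zeta> S" "Sigma0 lam X \<zeta> T"
  shows "Sigma0 lam X \<zeta> (S \<union> T)"
proof -
  have "Sigma0 lam X \<zeta> (\<Union>i\<in>{S, T}. i)"
    using assms Sigma0_index by (intro Sigma0_UN) (auto simp: finite_ordLeq)
  then show ?thesis by simp
qed

text \<open>Intersection distributes over the two unions, and the complement of a piece
  \<open>A i \<inter> B j\<close> is a union of two sets of lower class.\<close>

lemma Sigma0_Int:
  assumes "Sigma0 lam X \<zeta> S" "Sigma0 lam X \<zeta> T"
  shows "Sigma0 lam X \<zeta> (S \<inter> T)"
proof (cases "\<zeta> = ord_one r")
  case True
  then show ?thesis using assms by (auto simp: Sigma0_one_iff)
next
  case False
  then have one: "ord_one r \<lless> \<zeta>" using assms(1) Sigma0_index by (auto simp: underS_def)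
  obtain A z where A: "S = (\<Union>i\<in>Field lam. A i)"
    "\<And>i. i \<in> Field lam \<Longrightarrow> A i \<subseteq> topspace X \<and> z i \<lless> \<zeta> \<and> Sigma0 lam X (z i) (topspace X - A i)"
    using Sigma0_UnionE assms(1) one by metis
  obtain B w where B: "T = (\<Union>i\<in>Field lam. B i)"
    "\<And>i. i \<in> Field lam \<Longrightarrow> B i \<subseteq> topspace X \<and> w i \<lless> \<zeta> \<and> Sigma0 lam X (w i) (topspace X - B i)"
    using Sigma0_UnionE assms(2) one by metis
  have "Sigma0 lam X \<zeta> (\<Union>q\<in>Field lam \<times> Field lam. A (fst q) \<inter> B (snd q))"
  proof (rule Sigma0_UnionI[OF one])
    show "|Field lam \<times> Field lam| \<le>o lam"
      by (intro Times_ordLeq Field_lam_ordLeq)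
  next
    fix q assume "q \<in> Field lam \<times> Field lam"
    then obtain i j where q: "q = (i, j)" "i \<in> Field lam" "j \<in> Field lam" by blast
    show "A (fst q) \<inter> B (snd q) \<subseteq> topspace X" using q A(2) by fastforce
    \<comment> \<open>\<open>v\<close> is the larger of the two levels.\<close>
    obtain v where "v \<lless> \<zeta>" "(z i, v) \<in> r" "(w j, v) \<in> r"
      using A(2)[OF q(2)] B(2)[OF q(3)] less_linear less_Field le_iff by metis
    then have "v \<lless> \<zeta> \<and> Sigma0 lam X v ((topspace X - A i) \<union> (topspace X - B j))"
      using A(2)[OF q(2)] B(2)[OF q(3)] Sigma0_mono Sigma0_Un by blast
    moreover have "(topspace X - A i) \<union> (topspace X - B j) = topspace X - (A i \<inter> B j)" by blast
    ultimately show "\<exists>v. v \<lless> \<zeta> \<and> Sigma0 lam X v (topspace X - (A (fst q) \<inter> B (snd q)))"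
      using q by auto
  qed
  moreover have "(\<Union>q\<in>Field lam \<times> Field lam. A (fst q) \<inter> B (snd q)) = S \<inter> T"
    using A(1) B(1) by fastforce
  ultimately show ?thesis by simp
qed

lemma Sigma0_finite_INT:
  assumes "finite F" "(ord_one r, \<zeta>) \<in> r" "\<And>p. p \<in> F \<Longrightarrow> Sigma0 lam X \<zeta> (S p)"
  shows "Sigma0 lam X \<zeta> {x \<in> topspace X. \<forall>p\<in>F. x \<in> S p}"
  using assms(1,3)
proof (induction F)
  case empty
  then show ?case using Sigma0_topspace[OF assms(2)] by simp
next
  case (insert p F)
  have "{x \<in> topspace X. \<forall>q\<in>insert p F. x \<in> S q} = S p \<inter> {x \<in> topspace X. \<forall>q\<in>F. x \<in> S q}"
    by auto
  then show ?case using insert Sigma0_Int by simp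
qed

text \<open>There are at most \<open>lam\<close> sets of each finite size, by induction on the size,
  and only countably many sizes.\<close>

lemma Fpow_ordLeq: "|Fpow (Field lam)| \<le>o lam"
proof -
  define P where "P n = {B. B \<subseteq> Field lam \<and> finite B \<and> card B = n}" for n
  have P: "|P n| \<le>o lam" for n
  proof (induction n)
    case 0
    have "P 0 \<subseteq> {{}}" by (auto simp: P_def)
    then show ?case using finite_ordLeq finite_subset by blast
  next
    case (Suc n)
    have "P (Suc n) \<subseteq> (\<lambda>(a, B). insert a B) ` (Field lam \<times> P n)"
    proof
      fix B assume B: "B \<in> P (Suc n)"
      then obtain a C where "B = insert a C" "a \<notin> C" "card C = n" "n = 0 \<longrightarrow> C = {}"
        by (auto simp: P_def card_Suc_eq)
      then show "B \<in> (\<lambda>(a, B). insert a B) ` (Field lam \<times> P n)"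
        using B by (auto simp: P_def)
    qed
    then have "|P (Suc n)| \<le>o |(\<lambda>(a, B). insert a B) ` (Field lam \<times> P n)|"
      by (rule card_of_mono1)
    also have "|(\<lambda>(a, B). insert a B) ` (Field lam \<times> P n)| \<le>o |Field lam \<times> P n|"
      by (rule card_of_image)
    also have "|Field lam \<times> P n| \<le>o lam"
      using Field_lam_ordLeq Suc by (rule Times_ordLeq)
    finally show ?case .
  qed
  have "|UNIV :: nat set| \<le>o lam"
    using card_of_nat inf by (rule ordIso_ordLeq_trans)
  then have "|\<Union>n. P n| \<le>o lam"
    using card_of_UNION_ordLeq_infinite_Field[OF infinite_lam card] P by blast
  moreover have "(\<Union>n. P n) = Fpow (Field lam)"
    by (auto simp: P_def Fpow_def)
  ultimately show ?thesis by simp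
qed

section \<open>Limits of measurable functions\<close>

text \<open>The preimage of \<open>U\<close> under the limit is the union of the sets
  \<open>C d\<close> intersected with the preimages under \<open>g d\<close>.\<close>

lemma stable_lim_meas_fun_less_subset:
  assumes "ord_limit r \<xi>" "Refl D" "|Field D| \<le>o lam"
  shows "stable_lim lam \<xi> D X Y (meas_fun_less lam \<xi> X Y) \<subseteq> meas_fun lam \<xi> X Y"
proof
  fix f assume "f \<in> stable_lim lam \<xi> D X Y (meas_fun_less lam \<xi> X Y)"
  then obtain g C where f: "f \<in> topspace X \<rightarrow>\<^sub>E topspace Y"
    and g: "\<forall>d\<in>Field D. g d \<in> meas_fun_less lam \<xi> X Y"
    and cover: "(\<Union>d\<in>Field D. C d) = topspace X"
    and C: "\<forall>d\<in>Field D. Sigma0 lam X \<xi> (C d)"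
    and stable: "\<forall>d e. (d, e) \<in> D \<longrightarrow> C d \<subseteq> C e \<and> (\<forall>x\<in>C d. g e x = f x)"
    unfolding stable_lim_def by blast
  have "Sigma0 lam X \<xi> {x \<in> topspace X. f x \<in> U}" if U: "openin Y U" for U
  proof -
    have "Sigma0 lam X \<xi> (\<Union>d\<in>Field D. C d \<inter> {x \<in> topspace X. g d x \<in> U})"
    proof (rule Sigma0_UN[OF _ assms(3)])
      show "(ord_one r, \<xi>) \<in> r" using limit_one[OF assms(1)] by (simp add: underS_def)
      fix d assume d: "d \<in> Field D"
      with g obtain \<zeta> where "\<zeta> \<lless> \<xi>" "g d \<in> meas_fun lam \<zeta> X Y"
        unfolding meas_fun_less_def by blast
      then have "Sigma0 lam X \<xi> {x \<in> topspace X. g d x \<in> U}"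
        using U Sigma0_mono_less unfolding meas_fun_def by blast
      then show "Sigma0 lam X \<xi> (C d \<inter> {x \<in> topspace X. g d x \<in> U})"
        using C d Sigma0_Int by blast
    qed
    \<comment> \<open>Reflexivity of \<open>D\<close> allows \<open>e = d\<close> in the stability
      condition.\<close>
    moreover have "g d x = f x" if "d \<in> Field D" "x \<in> C d" for d x
      using assms(2) stable that by (meson refl_onD)
    then have "(\<Union>d\<in>Field D. C d \<inter> {x \<in> topspace X. g d x \<in> U}) = {x \<in> topspace X. f x \<in> U}"
      using cover by fastforce
    ultimately show ?thesis by simp
  qed
  with f show "f \<in> meas_fun lam \<xi> X Y" by (simp add: meas_fun_def)
qed

lemma net_lim_meas_fun_subset:
  assumes "ord_one r \<lless> ord_succ r \<xi>" "\<xi> \<in> Field r" "regular_space Y" "weight_le Y lam"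
  shows "net_lim (Fin_order lam) X Y (meas_fun lam \<xi> X Y) \<subseteq> meas_fun lam (ord_succ r \<xi>) X Y"
proof
  fix f assume "f \<in> net_lim (Fin_order lam) X Y (meas_fun lam \<xi> X Y)"
  then obtain g where f: "f \<in> topspace X \<rightarrow>\<^sub>E topspace Y"
    and g: "\<And>F. F \<in> Fpow (Field lam) \<Longrightarrow> g F \<in> meas_fun lam \<xi> X Y"
    and lim: "\<And>x. x \<in> topspace X \<Longrightarrow>
      limitin Y (\<lambda>F. g F x) (f x) (finite_subsets_at_top (Field lam))"
    unfolding net_lim_def Field_Fin_order tails_Fin_order by blast
  obtain b where b: "\<And>i. i \<in> Field lam \<Longrightarrow> openin Y (b i)"
    "\<And>U x. openin Y U \<Longrightarrow> x \<in> U \<Longrightarrow> \<exists>i\<in>Field lam. x \<in> b i \<and> b i \<subseteq> U"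
    using weight_le_enumerate card assms(4) by metis
  have "Sigma0 lam X (ord_succ r \<xi>) {x \<in> topspace X. f x \<in> U}" if U: "openin Y U" for U
  proof -
    define I where "I = {i \<in> Field lam. Y closure_of b i \<subseteq> U}"
    \<comment> \<open>With \<open>q = (i, F)\<close>: from \<open>F\<close> onwards all values stay
      in the closure of \<open>b i\<close>. The complement is a union of preimages of open sets,
      hence of class \<xi>, which puts \<open>S q\<close> one level higher.\<close>
    define S where "S q = {x \<in> topspace X. \<forall>F\<in>Fpow (Field lam). snd q \<subseteq> F \<longrightarrow>
      g F x \<in> Y closure_of b (fst q)}" for q
    have "Sigma0 lam X (ord_succ r \<xi>) (\<Union>q\<in>I \<times> Fpow (Field lam). S q)"
    proof (rule Sigma0_UnionI[OF assms(1)])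
      show "|I \<times> Fpow (Field lam)| \<le>o lam"
        by (intro Times_ordLeq Fpow_ordLeq subset_Field_lam_ordLeq) (auto simp: I_def)
      fix q
      show "S q \<subseteq> topspace X" by (auto simp: S_def)
      define Q where "Q = {F \<in> Fpow (Field lam). snd q \<subseteq> F}"
      have "Sigma0 lam X \<xi> (\<Union>F\<in>Q. {x \<in> topspace X. g F x \<in> topspace Y - Y closure_of b (fst q)})"
      proof (rule Sigma0_UN)
        show "(ord_one r, \<xi>) \<in> r" using assms(1,2) less_succ_iff by blast
        have "|Q| \<le>o |Fpow (Field lam)|" by (rule card_of_mono1) (auto simp: Q_def)
        then show "|Q| \<le>o lam" using Fpow_ordLeq by (rule ordLeq_transitive)
        fix F assume "F \<in> Q"
        then have "g F \<in> meas_fun lam \<xi> X Y" using g by (auto simp: Q_def)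
        moreover have "openin Y (topspace Y - Y closure_of b (fst q))"
          by (simp add: openin_diff)
        ultimately show "Sigma0 lam X \<xi> {x \<in> topspace X. g F x \<in> topspace Y - Y closure_of b (fst q)}"
          unfolding meas_fun_def by blast
      qed
      moreover have "g F x \<in> topspace Y" if "F \<in> Q" "x \<in> topspace X" for F x
        using g that by (auto simp: Q_def meas_fun_def)
      then have "(\<Union>F\<in>Q. {x \<in> topspace X. g F x \<in> topspace Y - Y closure_of b (fst q)}) =
        topspace X - S q"
        by (auto simp: S_def Q_def)
      ultimately show "\<exists>z. z \<lless> ord_succ r \<xi> \<and> Sigma0 lam X z (topspace X - S q)"
        using less_succ[OF assms(2)] by auto
    qed
    moreover have "(\<Union>q\<in>I \<times> Fpow (Field lam). S q) = {x \<in> topspace X. f x \<in> U}"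
    proof (intro equalityI subsetI)
      fix x assume "x \<in> (\<Union>q\<in>I \<times> Fpow (Field lam). S q)"
      then obtain i F where q: "i \<in> I" "F \<in> Fpow (Field lam)" "x \<in> S (i, F)" by auto
      then have x: "x \<in> topspace X" by (simp add: S_def)
      have "\<forall>\<^sub>F F' in finite_subsets_at_top (Field lam). g F' x \<in> Y closure_of b i"
        unfolding eventually_finite_subsets_Fpow
        using q by (intro bexI[of _ F]) (simp_all add: S_def)
      then have "f x \<in> Y closure_of b i"
        \<comment> \<open>Closed sets keep limits along a nontrivial filter.\<close>
        by (rule limitin_closedin[OF lim[OF x] closedin_closure_of]) simp
      with q x show "x \<in> {x \<in> topspace X. f x \<in> U}" by (auto simp: I_def)
    next
      fix x assume "x \<in> {x \<in> topspace X. f x \<in> U}"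
      then have x: "x \<in> topspace X" "f x \<in> U" by auto
      obtain i where i: "i \<in> Field lam" "f x \<in> b i" "Y closure_of b i \<subseteq> U"
        using regular_base_closure[OF assms(3) U x(2) b(2)] by blast
      then have "\<forall>\<^sub>F F in finite_subsets_at_top (Field lam). g F x \<in> b i"
        using lim[OF x(1)] b(1)[OF i(1)] unfolding limitin_def by blast
      then obtain F where F: "F \<in> Fpow (Field lam)"
        "\<forall>F'\<in>Fpow (Field lam). F \<subseteq> F' \<longrightarrow> g F' x \<in> b i"
        unfolding eventually_finite_subsets_Fpow by (elim bexE)
      moreover have "b i \<subseteq> Y closure_of b i"
        by (rule closure_of_subset[OF openin_subset[OF b(1)[OF i(1)]]])
      ultimately have "x \<in> S (i, F)" using x(1) unfolding S_def by auto
      with i F(1) show "x \<in> (\<Union>q\<in>I \<times> Fpow (Field lam). S q)" by (auto simp: I_def)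
    qed
    ultimately show ?thesis by simp
  qed
  with f show "f \<in> meas_fun lam (ord_succ r \<xi>) X Y" by (simp add: meas_fun_def)
qed

section \<open>Approximation of functions of class \<xi> + 1\<close>

text \<open>\<open>\<rho> d\<close> is one level below \<xi> that bounds all \<open>U p e\<close>
  with \<open>e\<close> up to \<open>d\<close> in \<open>D\<close>. Since the value of
  \<open>g\<close> is determined by the first consistent stage and a subset of the finite set
  \<open>F\<close>, its preimages split into at most \<open>lam\<close> pieces of level just above
  \<open>\<rho> d\<close>.\<close>

lemma stable_selection:
  assumes lim: "ord_limit r \<xi>"
    and D: "Well_order D" "|Field D| \<le>o lam" "Field D \<noteq> {}"
    and F: "finite F"
    and mono: "\<And>p d e. p \<in> F \<Longrightarrow> (d, e) \<in> D \<Longrightarrow> U p d \<subseteq> U p e"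
    and A: "\<And>p. p \<in> F \<Longrightarrow> topspace X - A p = (\<Union>d\<in>Field D. U p d)"
    and \<rho>: "\<And>d. d \<in> Field D \<Longrightarrow> \<rho> d \<lless> \<xi> \<and> (ord_one r, \<rho> d) \<in> r"
    and U: "\<And>p d e. p \<in> F \<Longrightarrow> (e, d) \<in> D \<Longrightarrow> Sigma0 lam X (\<rho> d) (U p e)"
    and f: "f \<in> topspace X \<rightarrow>\<^sub>E topspace Y"
  obtains g where "g \<in> stable_lim lam \<xi> D X Y (meas_fun_less lam \<xi> X Y)"
    "\<And>x. x \<in> topspace X \<Longrightarrow> \<exists>x'\<in>topspace X. g x = f x' \<and> (\<forall>p\<in>F. x \<in> A p \<longrightarrow> x' \<in> A p)"
proof -
  define T where "T d x = {p \<in> F. x \<notin> U p d}" for d x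
  define good where "good P \<longleftrightarrow> (\<exists>x\<in>topspace X. \<forall>p\<in>P. x \<in> A p)" for P
  \<comment> \<open>The chosen point depends on \<open>P\<close> alone, not on the point being
    approximated; this is what keeps the pieces simple.\<close>
  define s where "s P = (SOME x. x \<in> topspace X \<and> (\<forall>p\<in>P. x \<in> A p))" for P
  define W where "W d = {x \<in> topspace X. good (T d x)}" for d
  define e where "e x = wo_rel.minim D {d \<in> Field D. x \<in> W d}" for x
  define G where "G = restrict (\<lambda>x. f (s (T (e x) x))) (topspace X)"
  \<comment> \<open>Outside \<open>W d\<close> the value is the default \<open>f (s {})\<close>,
    which lies in \<open>Y\<close> as soon as \<open>X\<close> has a point.\<close>
  define g where "g d = restrict (\<lambda>x. if x \<in> W d then G x else f (s {})) (topspace X)" for d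
  have wo: "wo_rel D" using D(1) by (simp add: wo_rel_def)
  have s: "s P \<in> topspace X \<and> (\<forall>p\<in>P. s P \<in> A p)" if "good P" for P
    using that unfolding good_def s_def Bex_def by (rule someI_ex)
  have good_anti: "good P'" if "P' \<subseteq> P" "good P" for P P'
    using that unfolding good_def by blast
  have good_empty: "good {}" if "x \<in> topspace X" for x
    using that unfolding good_def by blast
  have T_sub: "T d x \<subseteq> F" for d x by (auto simp: T_def)
  have T_anti: "T d' x \<subseteq> T d x" if "(d, d') \<in> D" for d d' x
    using mono[OF _ that] by (auto simp: T_def)
  have W_mono: "W d \<subseteq> W d'" if "(d, d') \<in> D" for d d'
    using good_anti[OF T_anti[OF that]] by (auto simp: W_def)
  have W_cover: "\<exists>d\<in>Field D. x \<in> W d" if x: "x \<in> topspace X" for x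
  proof -
    \<comment> \<open>Each false condition is refuted at some stage, and remains so; finitely many
      stages have a common upper bound.\<close>
    have "\<exists>d\<in>Field D. \<forall>p\<in>P. x \<notin> A p \<longrightarrow> x \<in> U p d" if "finite P" "P \<subseteq> F" for P
      using that
    proof (induction P)
      case empty
      then show ?case using D(3) by blast
    next
      case (insert q P)
      then obtain d where d: "d \<in> Field D" "\<forall>p\<in>P. x \<notin> A p \<longrightarrow> x \<in> U p d" by auto
      show ?case
      proof (cases "x \<in> A q")
        case True
        with d show ?thesis by auto
      next
        case False
        then obtain d' where d': "d' \<in> Field D" "x \<in> U q d'" using A[of q] x insert.prems by auto
        obtain c where "(d, c) \<in> D" "(d', c) \<in> D"
          using wo_rel.TOTALS[OF wo] wo_rel.REFL[OF wo] d(1) d'(1) by (meson refl_onD)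
        moreover from this have "c \<in> Field D" by (auto simp: Field_def)
        ultimately show ?thesis using d d' mono insert.prems by (intro bexI[of _ c]) blast+
      qed
    qed
    from this[OF F subset_refl] obtain d where "d \<in> Field D" "\<forall>p\<in>F. x \<notin> A p \<longrightarrow> x \<in> U p d"
      by blast
    \<comment> \<open>At such a stage \<open>x\<close> itself is a common point of the surviving
      conditions.\<close>
    with x show ?thesis by (auto simp: W_def good_def T_def)
  qed
  have e: "e x \<in> Field D \<and> x \<in> W (e x) \<and> (\<forall>d\<in>Field D. x \<in> W d \<longrightarrow> (e x, d) \<in> D)"
    if "x \<in> topspace X" for x
  proof -
    have "{d \<in> Field D. x \<in> W d} \<noteq> {}" using W_cover[OF that] by blast
    then have "e x \<in> {d \<in> Field D. x \<in> W d}"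
      unfolding e_def by (intro wo_rel.minim_in[OF wo]) auto
    moreover have "(e x, d) \<in> D" if "d \<in> {d \<in> Field D. x \<in> W d}" for d
      unfolding e_def using that by (intro wo_rel.minim_least[OF wo]) auto
    ultimately show ?thesis by blast
  qed
  have D_sub: "|{c. (c, d) \<in> D}| \<le>o lam" for d
  proof -
    have "|{c. (c, d) \<in> D}| \<le>o |Field D|" by (rule card_of_mono1) (auto simp: Field_def)
    then show ?thesis using D(2) by (rule ordLeq_transitive)
  qed
  \<comment> \<open>This set consists of the points with \<open>T c x \<subseteq> P\<close>.\<close>
  have outside: "Sigma0 lam X (\<rho> d) {x \<in> topspace X. \<forall>p\<in>F - P. x \<in> U p c}"
    if "(c, d) \<in> D" for c d P
    using F U that \<rho>[of d] by (intro Sigma0_finite_INT) (auto simp: Field_def)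
  have W: "Sigma0 lam X (\<rho> d) (W c)" if cd: "(c, d) \<in> D" for c d
  proof -
    have d: "d \<in> Field D" using cd by (auto simp: Field_def)
    \<comment> \<open>Subsets of good sets are good, so \<open>W c\<close> is a finite union of the
      sets from \<open>outside\<close>, without complements.\<close>
    have "Sigma0 lam X (\<rho> d) (\<Union>P\<in>{P \<in> Pow F. good P}. {x \<in> topspace X. \<forall>p\<in>F - P. x \<in> U p c})"
      using F \<rho>[OF d] outside[OF cd] by (intro Sigma0_UN finite_ordLeq) auto
    moreover have "(\<Union>P\<in>{P \<in> Pow F. good P}. {x \<in> topspace X. \<forall>p\<in>F - P. x \<in> U p c}) = W c"
    proof (intro equalityI subsetI)
      fix x assume "x \<in> (\<Union>P\<in>{P \<in> Pow F. good P}. {x \<in> topspace X. \<forall>p\<in>F - P. x \<in> U p c})"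
      then obtain P where "good P" "x \<in> topspace X" "T c x \<subseteq> P" by (auto simp: T_def)
      then show "x \<in> W c" using good_anti by (auto simp: W_def)
    next
      fix x assume "x \<in> W c"
      then show "x \<in> (\<Union>P\<in>{P \<in> Pow F. good P}. {x \<in> topspace X. \<forall>p\<in>F - P. x \<in> U p c})"
        by (intro UN_I[of "T c x"]) (auto simp: W_def T_def)
    qed
    ultimately show ?thesis by simp
  qed
  have first: "Sigma0 lam X (ord_succ r (\<rho> d)) {x \<in> topspace X. e x = c \<and> T c x = P}"
    if cd: "(c, d) \<in> D" and P: "P \<in> Pow F" "good P" for c d P
  proof -
    have d: "c \<in> Field D" "d \<in> Field D" using cd by (auto simp: Field_def)
    have succ: "\<rho> d \<lless> ord_succ r (\<rho> d)" using \<rho>[OF d(2)] less_succ less_Field by blast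
    have sub: "(c', d) \<in> D" if "c' \<in> underS D c" for c'
      using that cd wo_rel.TRANS[OF wo] by (meson transD underS_E)
    have "|underS D c| \<le>o |{c. (c, d) \<in> D}|" by (rule card_of_mono1) (use sub in auto)
    then have "|underS D c| \<le>o lam" using D_sub by (rule ordLeq_transitive)
    then have "Sigma0 lam X (\<rho> d) (\<Union>c'\<in>underS D c. W c')"
      using \<rho>[OF d(2)] W sub by (intro Sigma0_UN) auto
    moreover have "Sigma0 lam X (\<rho> d) (\<Union>p\<in>P. U p c)"
      using \<rho>[OF d(2)] U[OF _ cd] P F by (intro Sigma0_UN finite_ordLeq) (auto intro: finite_subset)
    \<comment> \<open>The factors say \<open>T c x \<subseteq> P\<close>,
      \<open>P \<subseteq> T c x\<close>, and that no earlier stage is consistent. The two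
      complements cost one level.\<close>
    ultimately have "Sigma0 lam X (ord_succ r (\<rho> d)) ({x \<in> topspace X. \<forall>p\<in>F - P. x \<in> U p c} \<inter>
      (topspace X - (\<Union>p\<in>P. U p c)) \<inter> (topspace X - (\<Union>c'\<in>underS D c. W c')))"
      using outside[OF cd] succ by (intro Sigma0_Int Sigma0_Diff Sigma0_mono_less[OF _ succ])
    moreover have "{x \<in> topspace X. \<forall>p\<in>F - P. x \<in> U p c} \<inter>
      (topspace X - (\<Union>p\<in>P. U p c)) \<inter> (topspace X - (\<Union>c'\<in>underS D c. W c')) =
      {x \<in> topspace X. e x = c \<and> T c x = P}" (is "?L = ?R")
    proof (intro equalityI subsetI)
      fix x assume x: "x \<in> ?L"
      then have "T c x = P" using P(1) by (auto simp: T_def)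
      then have "x \<in> W c" using x P(2) by (auto simp: W_def)
      then have "(e x, c) \<in> D" "e x \<notin> underS D c" using e[of x] x d(1) by auto
      then show "x \<in> ?R" using x \<open>T c x = P\<close> by (auto simp: underS_def)
    next
      fix x assume x: "x \<in> ?R"
      have "x \<notin> W c'" if "c' \<in> underS D c" for c'
      proof
        assume "x \<in> W c'"
        moreover have "c' \<in> Field D" using that by (auto simp: underS_def Field_def)
        ultimately have "(c, c') \<in> D" using e[of x] x by auto
        then show False using that wo_rel.ANTISYM[OF wo] by (auto simp: underS_def dest: antisymD)
      qed
      with x show "x \<in> ?L" by (auto simp: T_def)
    qed
    ultimately show ?thesis by simp
  qed
  have G: "G x = f (s (T (e x) x)) \<and> good (T (e x) x)" if "x \<in> topspace X" for x
    using that e[OF that] by (simp add: G_def W_def)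
  have G_Y: "G \<in> topspace X \<rightarrow>\<^sub>E topspace Y"
    using G s f by (auto simp: G_def PiE_iff)
  have g: "g d \<in> meas_fun_less lam \<xi> X Y" if d: "d \<in> Field D" for d
  proof -
    \<comment> \<open>Still below \<xi>, because \<xi> is a limit.\<close>
    define \<sigma> where "\<sigma> = ord_succ r (\<rho> d)"
    have succ: "\<rho> d \<lless> \<sigma>" using \<rho>[OF d] less_succ less_Field by (auto simp: \<sigma>_def)
    have \<sigma>: "\<sigma> \<lless> \<xi>" "(ord_one r, \<sigma>) \<in> r" 
      using limit_succ[OF lim] \<rho>[OF d] one_least[OF succ] by (auto simp: \<sigma>_def)
    have "\<sigma> \<noteq> ord_zero r"
      using succ zero_least less_Field wo_rel.ANTISYM[OF wo_r] by (metis antisymD underS_E)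
    have dd: "(d, d) \<in> D" using wo_rel.REFL[OF wo] d by (rule refl_onD)
    have "Sigma0 lam X \<sigma> {x \<in> topspace X. g d x \<in> V}" for V
    proof -
      \<comment> \<open>Off \<open>W d\<close> the function is constant, so the preimage there is
        everything or nothing. \<open>Q\<close> lists the possible first stages and surviving sets
        inside \<open>W d\<close>.\<close>
      define N where "N = (if f (s {}) \<in> V then topspace X - W d else {})"
      define Q where "Q = {c. (c, d) \<in> D} \<times> {P \<in> Pow F. good P \<and> f (s P) \<in> V}"
      have "Sigma0 lam X \<sigma> (\<Union>q\<in>Q. {x \<in> topspace X. e x = fst q \<and> T (fst q) x = snd q})"
        using F \<sigma> first unfolding Q_def \<sigma>_def
        by (intro Sigma0_UN Times_ordLeq D_sub finite_ordLeq) auto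
      moreover have "Sigma0 lam X \<sigma> N"
        using Sigma0_Diff[OF W[OF dd] succ] Sigma0_empty[OF \<sigma>(2)] by (simp add: N_def)
      ultimately have "Sigma0 lam X \<sigma>
        ((\<Union>q\<in>Q. {x \<in> topspace X. e x = fst q \<and> T (fst q) x = snd q}) \<union> N)"
        by (rule Sigma0_Un)
      moreover have "(\<Union>q\<in>Q. {x \<in> topspace X. e x = fst q \<and> T (fst q) x = snd q}) =
        {x \<in> W d. G x \<in> V}"
      proof (intro equalityI subsetI)
        fix x assume "x \<in> (\<Union>q\<in>Q. {x \<in> topspace X. e x = fst q \<and> T (fst q) x = snd q})"
        then have x: "x \<in> topspace X" "(e x, d) \<in> D" "f (s (T (e x) x)) \<in> V"
          by (auto simp: Q_def)
        then show "x \<in> {x \<in> W d. G x \<in> V}" using e[of x] W_mono G by auto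
      next
        fix x assume x: "x \<in> {x \<in> W d. G x \<in> V}"
        then have "x \<in> topspace X" by (auto simp: W_def)
        then have "(e x, T (e x) x) \<in> Q" using x e[of x] G d T_sub by (auto simp: Q_def)
        then show "x \<in> (\<Union>q\<in>Q. {x \<in> topspace X. e x = fst q \<and> T (fst q) x = snd q})"
          using \<open>x \<in> topspace X\<close> by (intro UN_I) auto
      qed
      moreover have "{x \<in> W d. G x \<in> V} \<union> N = {x \<in> topspace X. g d x \<in> V}"
        by (auto simp: N_def g_def W_def)
      ultimately show ?thesis by simp
    qed
    moreover have "g d \<in> topspace X \<rightarrow>\<^sub>E topspace Y"
      using G_Y s[OF good_empty] f by (auto simp: g_def PiE_iff)
    ultimately show ?thesis
      using \<sigma>(1) \<open>\<sigma> \<noteq> ord_zero r\<close> by (auto simp: meas_fun_less_def meas_fun_def)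
  qed
  have "G \<in> stable_lim lam \<xi> D X Y (meas_fun_less lam \<xi> X Y)"
  proof -
    have "(\<Union>d\<in>Field D. W d) = topspace X" using W_cover by (auto simp: W_def)
    moreover have "Sigma0 lam X \<xi> (W d)" if d: "d \<in> Field D" for d
      using W[OF refl_onD[OF wo_rel.REFL[OF wo] d]] \<rho>[OF d] Sigma0_mono_less by blast
    moreover have "W d \<subseteq> W d' \<and> (\<forall>x\<in>W d. g d' x = G x)" if "(d, d') \<in> D" for d d'
      using W_mono[OF that] by (auto simp: g_def W_def)
    ultimately show ?thesis
      unfolding stable_lim_def using G_Y g
      by (intro CollectI conjI exI[of _ g] exI[of _ W] ballI allI impI) (assumption | simp)+
  qed
  moreover have "\<exists>x'\<in>topspace X. G x = f x' \<and> (\<forall>p\<in>F. x \<in> A p \<longrightarrow> x' \<in> A p)"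
    if x: "x \<in> topspace X" for x
  proof (intro bexI conjI ballI impI)
    show "G x = f (s (T (e x) x))" using G[OF x] ..
    show "s (T (e x) x) \<in> topspace X" using G[OF x] s by blast
    fix p assume "p \<in> F" "x \<in> A p"
    \<comment> \<open>\<open>U p d\<close> is disjoint from \<open>A p\<close>, so a true condition
      is never refuted.\<close>
    then have "p \<in> T (e x) x" using A[of p] e[OF x] by (auto simp: T_def)
    then show "s (T (e x) x) \<in> A p" using G[OF x] s by blast
  qed
  ultimately show ?thesis by (rule that)
qed

text \<open>The order of \<^term>\<open>ord_cof r \<xi>\<close> on its field is unrelated to that of \<^term>\<open>cardSuc lam\<close>, so
  initial segments are bounded in \<open>\<xi>\<close> only by minimality of the cardinality: this is \<open>\<rho>\<close>.\<close>

lemma ord_cof_limit: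
  assumes "ord_limit r \<xi>"
  obtains \<rho> where "Well_order (ord_cof r \<xi>)" "|Field (ord_cof r \<xi>)| \<le>o lam"
    "Field (ord_cof r \<xi>) \<subseteq> underS r \<xi>"
    "\<And>a. a \<lless> \<xi> \<Longrightarrow> \<exists>d\<in>Field (ord_cof r \<xi>). (a, d) \<in> r"
    "\<And>d. d \<in> Field (ord_cof r \<xi>) \<Longrightarrow> \<rho> d \<lless> \<xi>"
    "\<And>d c. (c, d) \<in> ord_cof r \<xi> \<Longrightarrow> c \<lless> \<rho> d"
proof -
  let ?R = "Restr r (underS r \<xi>)"
  have Field_R: "Field ?R = underS r \<xi>"
    using le_iff less_Field by (fastforce simp: Field_def)
  have "Refl ?R"
    unfolding Field_R refl_on_def using le_iff less_Field by auto
  then obtain A where A: "ord_cof r \<xi> = |A|" "unbounded_in ?R A"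
    "\<And>B. unbounded_in ?R B \<Longrightarrow> |A| \<le>o |B|"
    unfolding ord_cof_def by (rule cofinality_card_of) blast
  have sub: "A \<subseteq> underS r \<xi>" using A(2) unfolding unbounded_in_def Field_R by blast
  have "\<exists>\<rho>. \<rho> \<lless> \<xi> \<and> (\<forall>c. (c, d) \<in> |A| \<longrightarrow> c \<lless> \<rho>)" if d: "d \<in> A" for d
  proof -
    \<comment> \<open>A proper initial segment of a cardinal is smaller, so by minimality of
      \<open>A\<close> it is bounded in \<xi>.\<close>
    have "|underS |A| d| <o |A|"
      using card_of_underS[OF card_of_Card_order, of d A] d by (simp add: Field_card_of)
    then have "\<not> unbounded_in ?R (underS |A| d)"
      using A(3) not_ordLess_ordLeq by blast
    moreover have A_sub: "underS |A| d \<subseteq> A"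
      using Field_card_of[of A] by (auto simp: underS_def dest: FieldI1)
    ultimately obtain a where a: "a \<lless> \<xi>" "\<forall>c\<in>underS |A| d. (a, c) \<notin> ?R"
      using sub unfolding unbounded_in_def Field_R by blast
    have ca: "c \<lless> a" if "c \<in> underS |A| d" for c
    proof -
      have "c \<lless> \<xi>" using that A_sub sub by blast
      then show ?thesis using a that less_linear[of c a] le_iff less_Field by blast
    qed
    \<comment> \<open>The bound must also exceed \<open>d\<close> itself strictly, since
      \<open>c = d\<close> is allowed.\<close>
    have "ord_succ r d \<lless> \<xi>" using limit_succ[OF assms] sub d by blast
    then obtain \<rho> where \<rho>: "\<rho> \<lless> \<xi>" "(a, \<rho>) \<in> r" "(ord_succ r d, \<rho>) \<in> r"
      using a(1) less_linear less_Field le_iff by metis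
    have less_le: "c \<lless> \<rho>" if "c \<lless> b" "(b, \<rho>) \<in> r" for b c
      using that less_trans by (metis underS_I)
    have "d \<lless> \<rho>" using less_le[OF less_succ \<rho>(3)] sub d less_Field by blast
    moreover have "c \<lless> \<rho>" if "c \<in> underS |A| d" for c using less_le[OF ca[OF that] \<rho>(2)] .
    ultimately show ?thesis using \<rho>(1) by (metis underS_I)
  qed
  then obtain \<rho> where \<rho>: "\<And>d. d \<in> A \<Longrightarrow> \<rho> d \<lless> \<xi> \<and> (\<forall>c. (c, d) \<in> |A| \<longrightarrow> c \<lless> \<rho> d)"
    by metis
  have "|A| \<le>o |underS r \<xi>|" using sub by (rule card_of_mono1)
  moreover have "|underS r \<xi>| \<le>o lam"
    using card assms by (intro card_of_underS_cardSuc) (auto simp: ord_limit_def)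
  ultimately have "|A| \<le>o lam" by (rule ordLeq_transitive)
  show ?thesis
  proof (rule that[of \<rho>])
    show "Well_order (ord_cof r \<xi>)" unfolding A(1) by (rule card_of_Well_order)
    show "\<exists>d\<in>Field (ord_cof r \<xi>). (a, d) \<in> r" if "a \<lless> \<xi>" for a
      using A(2) that unfolding A(1) unbounded_in_def Field_R Field_card_of by auto
    show "c \<lless> \<rho> d" if "(c, d) \<in> ord_cof r \<xi>" for c d
      using that \<rho> unfolding A(1) by (metis FieldI2 Field_card_of)
  qed (use A(1) \<open>|A| \<le>o lam\<close> sub \<rho> in \<open>auto simp: Field_card_of\<close>)
qed

lemma meas_fun_succ_subset:
  assumes lim: "ord_limit r \<xi>" and Y: "weight_le Y lam"
  shows "meas_fun lam (ord_succ r \<xi>) X Y \<subseteq> net_lim (Fin_order lam) X Y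
    (stable_lim lam \<xi> (ord_cof r \<xi>) X Y (meas_fun_less lam \<xi> X Y))"
proof
  let ?D = "ord_cof r \<xi>"
  let ?S = "stable_lim lam \<xi> ?D X Y (meas_fun_less lam \<xi> X Y)"
  fix f assume "f \<in> meas_fun lam (ord_succ r \<xi>) X Y"
  then have f: "f \<in> topspace X \<rightarrow>\<^sub>E topspace Y"
    and meas: "\<And>U. openin Y U \<Longrightarrow> Sigma0 lam X (ord_succ r \<xi>) {x \<in> topspace X. f x \<in> U}"
    by (auto simp: meas_fun_def)
  obtain \<rho> where D: "Well_order ?D" "|Field ?D| \<le>o lam" "Field ?D \<subseteq> underS r \<xi>"
    and cof: "\<And>a. a \<lless> \<xi> \<Longrightarrow> \<exists>d\<in>Field ?D. (a, d) \<in> r"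
    and \<rho>: "\<And>d. d \<in> Field ?D \<Longrightarrow> \<rho> d \<lless> \<xi>" "\<And>d c. (c, d) \<in> ?D \<Longrightarrow> c \<lless> \<rho> d"
    using ord_cof_limit[OF lim] by metis
  have wo: "wo_rel ?D" using D(1) by (simp add: wo_rel_def)
  have refl_D: "(d, d) \<in> ?D" if "d \<in> Field ?D" for d
    using wo_rel.REFL[OF wo] that by (rule refl_onD)
  have \<xi>: "\<xi> \<in> Field r" "ord_one r \<lless> \<xi>" "ord_one r \<lless> ord_succ r \<xi>"
    using lim limit_one[OF lim] less_trans less_succ by (auto simp: ord_limit_def)
  obtain b where b: "\<And>i. i \<in> Field lam \<Longrightarrow> openin Y (b i)"
    "\<And>U x. openin Y U \<Longrightarrow> x \<in> U \<Longrightarrow> \<exists>i\<in>Field lam. x \<in> b i \<and> b i \<subseteq> U"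
    using weight_le_enumerate card Y by metis
  obtain h where h: "h ` Field lam = Field lam \<times> Field lam" by (rule enumerate_pairs)
  \<comment> \<open>A class below \<xi> + 1 is at most \<xi>, so the complements of all pieces can
    be put into class \<xi>.\<close>
  have "\<forall>i\<in>Field lam. \<exists>A. {x \<in> topspace X. f x \<in> b i} = (\<Union>j\<in>Field lam. A j) \<and>
    (\<forall>j\<in>Field lam. Sigma0 lam X \<xi> (topspace X - A j))"
  proof
    fix i assume i: "i \<in> Field lam"
    obtain A w where A: "{x \<in> topspace X. f x \<in> b i} = (\<Union>j\<in>Field lam. A j)"
      "\<And>j. j \<in> Field lam \<Longrightarrow> A j \<subseteq> topspace X \<and> w j \<lless> ord_succ r \<xi> \<and>
        Sigma0 lam X (w j) (topspace X - A j)"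
      by (rule Sigma0_UnionE[OF meas[OF b(1)[OF i]] \<xi>(3)]) (rule that)
    have "Sigma0 lam X \<xi> (topspace X - A j)" if "j \<in> Field lam" for j
      using A(2)[OF that] Sigma0_mono[of "w j" _ \<xi>] less_succ_iff[OF \<xi>(1), of "w j"] by simp
    with A(1) show "\<exists>A. {x \<in> topspace X. f x \<in> b i} = (\<Union>j\<in>Field lam. A j) \<and>
      (\<forall>j\<in>Field lam. Sigma0 lam X \<xi> (topspace X - A j))"
      by (intro exI[of _ A] conjI ballI)
  qed
  from bchoice[OF this] obtain A
    where "\<forall>i\<in>Field lam. {x \<in> topspace X. f x \<in> b i} = (\<Union>j\<in>Field lam. A i j) \<and>
      (\<forall>j\<in>Field lam. Sigma0 lam X \<xi> (topspace X - A i j))"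
    by (elim exE)
  then have A: "\<And>i. i \<in> Field lam \<Longrightarrow> {x \<in> topspace X. f x \<in> b i} = (\<Union>j\<in>Field lam. A i j)"
    "\<And>i j. i \<in> Field lam \<Longrightarrow> j \<in> Field lam \<Longrightarrow> Sigma0 lam X \<xi> (topspace X - A i j)"
    by simp_all
  define B where "B p = A (fst (h p)) (snd (h p))" for p
  have "\<forall>p\<in>Field lam. \<exists>C. topspace X - B p = (\<Union>k\<in>Field lam. C k) \<and> (\<forall>k\<in>Field lam.
      C k \<subseteq> topspace X \<and> (\<exists>z. z \<lless> \<xi> \<and> Sigma0 lam X z (topspace X - C k)))"
  proof
    fix p assume "p \<in> Field lam"
    then have "h p \<in> Field lam \<times> Field lam" using h by blast
    then have "Sigma0 lam X \<xi> (topspace X - B p)" using A(2) by (auto simp: B_def)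
    then obtain C z where C: "topspace X - B p = (\<Union>k\<in>Field lam. C k)"
      "\<And>k. k \<in> Field lam \<Longrightarrow>
        C k \<subseteq> topspace X \<and> z k \<lless> \<xi> \<and> Sigma0 lam X (z k) (topspace X - C k)"
      by (rule Sigma0_UnionE[OF _ \<xi>(2)]) (rule that)
    show "\<exists>C. topspace X - B p = (\<Union>k\<in>Field lam. C k) \<and> (\<forall>k\<in>Field lam.
      C k \<subseteq> topspace X \<and> (\<exists>z. z \<lless> \<xi> \<and> Sigma0 lam X z (topspace X - C k)))"
    proof (intro exI[of _ C] conjI ballI)
      fix k assume "k \<in> Field lam"
      from C(2)[OF this] show "C k \<subseteq> topspace X"
        "\<exists>z. z \<lless> \<xi> \<and> Sigma0 lam X z (topspace X - C k)" by auto
    qed (rule C(1))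
  qed
  from bchoice[OF this] obtain C
    where "\<forall>p\<in>Field lam. topspace X - B p = (\<Union>k\<in>Field lam. C p k) \<and> (\<forall>k\<in>Field lam.
      C p k \<subseteq> topspace X \<and> (\<exists>z. z \<lless> \<xi> \<and> Sigma0 lam X z (topspace X - C p k)))"
    by (elim exE)
  then have C: "\<And>p. p \<in> Field lam \<Longrightarrow> topspace X - B p = (\<Union>k\<in>Field lam. C p k)"
    "\<And>p k. p \<in> Field lam \<Longrightarrow> k \<in> Field lam \<Longrightarrow> C p k \<subseteq> topspace X"
    "\<And>p k. p \<in> Field lam \<Longrightarrow> k \<in> Field lam \<Longrightarrow> \<exists>z. z \<lless> \<xi> \<and> Sigma0 lam X z (topspace X - C p k)"
    by simp_all
  \<comment> \<open>Elements of \<open>Field ?D\<close> are ordinals below \<xi> and serve as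
    levels. Taking all levels \<open>c\<close> that precede \<open>d\<close> in \<open>?D\<close>,
    whose order is not that of \<open>r\<close>, makes \<open>U p\<close> increasing along
    \<open>?D\<close>.\<close>
  define K where "K p d = {k \<in> Field lam. \<exists>c. (c, d) \<in> ?D \<and> Sigma0 lam X c (topspace X - C p k)}"
    for p d
  define U where "U p d = (\<Union>k\<in>K p d. C p k)" for p d
  have "\<exists>g. g \<in> ?S \<and> (\<forall>x\<in>topspace X. \<exists>x'\<in>topspace X. g x = f x' \<and> (\<forall>p\<in>F. x \<in> B p \<longrightarrow> x' \<in> B p))"
    if F: "F \<in> Fpow (Field lam)" for F
  proof (rule stable_selection[OF lim D(1,2), where F = F and U = U and A = B and \<rho> = \<rho> and f = f])
    show "Field ?D \<noteq> {}" using cof[OF \<xi>(2)] by blast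
    show "finite F" using F by (simp add: Fpow_def)
    show "U p d \<subseteq> U p d'" if "p \<in> F" "(d, d') \<in> ?D" for p d d'
    proof -
      have "K p d \<subseteq> K p d'"
        using that(2) wo_rel.TRANS[OF wo] by (auto simp: K_def dest: transD)
      then show ?thesis by (auto simp: U_def)
    qed
    show "topspace X - B p = (\<Union>d\<in>Field ?D. U p d)" if "p \<in> F" for p
    proof -
      have p: "p \<in> Field lam" using F that by (auto simp: Fpow_def)
      have "\<exists>d\<in>Field ?D. k \<in> K p d" if k: "k \<in> Field lam" for k
      proof -
        obtain z where z: "z \<lless> \<xi>" "Sigma0 lam X z (topspace X - C p k)" 
          using C(3)[OF p k] by blast
        \<comment> \<open>Cofinality gives a stage above the level \<open>z\<close>, and classes may
          be raised to it.\<close>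
        obtain d where d: "d \<in> Field ?D" "(z, d) \<in> r" using cof[OF z(1)] by blast
        then have "k \<in> K p d"
          using k refl_D[OF d(1)] Sigma0_mono[OF z(2) d(2)] unfolding K_def by blast
        with d(1) show ?thesis ..
      qed
      then have "(\<Union>k\<in>Field lam. C p k) = (\<Union>d\<in>Field ?D. U p d)"
        by (fastforce simp: U_def K_def)
      then show ?thesis using C(1)[OF p] by simp
    qed
    show "\<rho> d \<lless> \<xi> \<and> (ord_one r, \<rho> d) \<in> r" if "d \<in> Field ?D" for d
      using \<rho>(1)[OF that] one_least[OF \<rho>(2)[OF refl_D[OF that]]] by blast
    show "Sigma0 lam X (\<rho> d) (U p c)" if "p \<in> F" and cd: "(c, d) \<in> ?D" for p d c
      unfolding U_def
    proof (rule Sigma0_UN)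
      show "(ord_one r, \<rho> d) \<in> r" using one_least[OF \<rho>(2)[OF cd]] .
      show "|K p c| \<le>o lam" by (rule subset_Field_lam_ordLeq) (auto simp: K_def)
      fix k assume "k \<in> K p c"
      then obtain c' where k: "k \<in> Field lam" "(c', c) \<in> ?D" "Sigma0 lam X c' (topspace X - C p k)"
        by (auto simp: K_def)
      have "(c', d) \<in> ?D" using transD[OF wo_rel.TRANS[OF wo] k(2) cd] .
      \<comment> \<open>\<open>c'\<close> is strictly below \<open>\<rho> d\<close>, which leaves
        room for a complement.\<close>
      then have "Sigma0 lam X (\<rho> d) (topspace X - (topspace X - C p k))"
        by (intro Sigma0_Diff[OF k(3)] \<rho>(2))
      moreover have "p \<in> Field lam" using F \<open>p \<in> F\<close> by (auto simp: Fpow_def)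
      ultimately show "Sigma0 lam X (\<rho> d) (C p k)"
        using C(2)[of p k] k(1) by (simp add: double_diff)
    qed
  qed (use f in blast)+
  then have "\<forall>F\<in>Fpow (Field lam). \<exists>g. g \<in> ?S \<and>
      (\<forall>x\<in>topspace X. \<exists>x'\<in>topspace X. g x = f x' \<and> (\<forall>p\<in>F. x \<in> B p \<longrightarrow> x' \<in> B p))"
    by (rule ballI)
  from bchoice[OF this] obtain g where "\<forall>F\<in>Fpow (Field lam). g F \<in> ?S \<and>
      (\<forall>x\<in>topspace X. \<exists>x'\<in>topspace X. g F x = f x' \<and> (\<forall>p\<in>F. x \<in> B p \<longrightarrow> x' \<in> B p))"
    by (elim exE)
  then have g: "\<And>F. F \<in> Fpow (Field lam) \<Longrightarrow> g F \<in> ?S"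
    "\<And>F x. F \<in> Fpow (Field lam) \<Longrightarrow> x \<in> topspace X \<Longrightarrow>
      \<exists>x'\<in>topspace X. g F x = f x' \<and> (\<forall>p\<in>F. x \<in> B p \<longrightarrow> x' \<in> B p)"
    by simp_all
  have "limitin Y (\<lambda>F. g F x) (f x) (finite_subsets_at_top (Field lam))" if x: "x \<in> topspace X" for x
    unfolding limitin_def
  proof (intro conjI allI impI)
    show "f x \<in> topspace Y" using f x by blast
    fix V assume "openin Y V \<and> f x \<in> V"
    then obtain i where i: "i \<in> Field lam" "f x \<in> b i" "b i \<subseteq> V" using b(2) by blast
    then obtain j where j: "j \<in> Field lam" "x \<in> A i j" using A(1) x by blast
    \<comment> \<open>\<open>{p}\<close> is the tail index: any \<open>F\<close> containing
      \<open>p\<close> forces the value at \<open>x\<close> into \<open>b i\<close>.\<close>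
    then obtain p where p: "p \<in> Field lam" "h p = (i, j)" using h i(1) by (metis SigmaI imageE)
    have "g F x \<in> V" if F: "F \<in> Fpow (Field lam)" "p \<in> F" for F
    proof -
      obtain x' where "x' \<in> topspace X" "g F x = f x'" "x' \<in> A i j"
        using g(2)[OF F(1) x] F(2) p(2) j(2) by (auto simp: B_def)
      then show ?thesis using A(1)[OF i(1)] i(3) j(1) by auto
    qed
    then show "\<forall>\<^sub>F F in finite_subsets_at_top (Field lam). g F x \<in> V"
      unfolding eventually_finite_subsets_Fpow using p(1)
      by (intro bexI[of _ "{p}"]) (auto simp: Fpow_def)
  qed
  with f g(1) show "f \<in> net_lim (Fin_order lam) X Y ?S"
    unfolding net_lim_def Field_Fin_order tails_Fin_order
    by (intro CollectI conjI exI[of _ g] ballI)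
qed

end

theorem theorem6p11:
  fixes lam :: "'k rel" and X :: "'a topology" and Y :: "'b topology" and \<xi> :: "'k set"
  assumes "Card_order lam" and "natLeq <o lam" and "two_pow_less lam =o lam"
    and "\<not> cofinality lam =o natLeq \<Longrightarrow>
           coinitiality_pos TYPE('g::linordered_field) =o cofinality lam"
    and "X \<in> metric_class TYPE('g) lam" and "Y \<in> metric_class TYPE('g) lam"
    and "cofinality lam =o natLeq \<Longrightarrow> has_covering_dim X 0 \<and> has_covering_dim Y 0"
    and "ord_limit (cardSuc lam) \<xi>"
  shows "meas_fun lam (ord_succ (cardSuc lam) \<xi>) X Y =
         net_lim (Fin_order lam) X Y
           (stable_lim lam \<xi> (ord_cof (cardSuc lam) \<xi>) X Y (meas_fun_less lam \<xi> X Y))"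
proof
  interpret lambda_hierarchy lam X
    using assms(1,2,5) ordLess_imp_ordLeq by unfold_locales (auto simp: metric_class_def)
  have Y: "regular_space Y" "weight_le Y lam"
    using assms(6) by (auto simp: metric_class_def)
  show "meas_fun lam (ord_succ r \<xi>) X Y \<subseteq> net_lim (Fin_order lam) X Y
    (stable_lim lam \<xi> (ord_cof r \<xi>) X Y (meas_fun_less lam \<xi> X Y))"
    using assms(8) Y(2) by (rule meas_fun_succ_subset)
  have D: "Well_order (ord_cof r \<xi>)" "|Field (ord_cof r \<xi>)| \<le>o lam"
    using ord_cof_limit[OF assms(8)] by metis+
  \<comment> \<open>Net limits are monotone in the class of functions, so stable limits may be
    replaced by functions of class \<xi>.\<close>
  have "stable_lim lam \<xi> (ord_cof r \<xi>) X Y (meas_fun_less lam \<xi> X Y) \<subseteq> meas_fun lam \<xi> X Y"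
    using assms(8) D wo_rel.REFL[unfolded wo_rel_def] by (intro stable_lim_meas_fun_less_subset)
  then have "net_lim (Fin_order lam) X Y
      (stable_lim lam \<xi> (ord_cof r \<xi>) X Y (meas_fun_less lam \<xi> X Y)) \<subseteq>
    net_lim (Fin_order lam) X Y (meas_fun lam \<xi> X Y)"
    unfolding net_lim_def by blast
  also have "\<dots> \<subseteq> meas_fun lam (ord_succ r \<xi>) X Y"
  proof (rule net_lim_meas_fun_subset[OF _ _ Y])
    show "\<xi> \<in> Field r" using assms(8) by (simp add: ord_limit_def)
    then show "ord_one r \<lless> ord_succ r \<xi>" using limit_one[OF assms(8)] less_succ less_trans by blast
  qed
  finally show "net_lim (Fin_order lam) X Y
      (stable_lim lam \<xi> (ord_cof r \<xi>) X Y (meas_fun_less lam \<xi> X Y)) \<subseteq>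
    meas_fun lam (ord_succ r \<xi>) X Y" .
qed

end
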